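(* Let $F=\{f_i\}_{i=1}^N$ be a Parseval $K$-frame for the Hilbert space $\mathcal{H}_n$, where $K\in\mathcal{B}(\mathcal{H}_n)$. Let $L:=\max\{\|f_i\|\,\|K^\dagger f_i\|:1\le i\le N\}$, $I_1:=\{i:\|f_i\|\,\|K^\dagger f_i\|=L\}$, $I_2:=\{1,\dots,N\}\setminus I_1$, and $V_j:=\operatorname{span}\{f_i:i\in I_j\}$ for $j=1,2$. Suppose $V_1\cap V_2=\{0\}$. Then the canonical $K$-dual $K^\dagger F=\{K^\dagger f_i\}_{i=1}^N$ of $F$ is a $1$-erasure optimal $K$-dual of $F$ with respect to the operator norm.
   Context: $\mathcal{H}_n$ is an $n$-dimensional Hilbert space (over $\mathbb{R}$ or $\mathbb{C}$) and $\mathcal{B}(\mathcal{H}_n)$ is the algebra of bounded linear operators on it. For $K\in\mathcal{B}(\mathcal{H}_n)$, a sequence $F=\{f_i\}_{i=1}^N\subset\mathcal{H}_n$ is a $K$-frame if there are constants $0<A\le B<\infty$ with $A\|K^*f\|^2\le\sum_{i=1}^N|\langle f,f_i\rangle|^2\le B\|f\|^2$ for all $f$; it is a Parseval $K$-frame if $\sum_{i=1}^N|\langle f,f_i\rangle|^2=\|K^*f\|^2$ for all $f$. A sequence $G=\{g_i\}_{i=1}^N\subset\mathcal{H}_n$ is a $K$-dual of $F$ if $Kf=\sum_{i=1}^N\langle f,g_i\rangle f_i$ for all $f\in\mathcal{H}_n$. $K^\dagger$ is the Moore–Penrose pseudoinverse of $K$; for a Parseval $K$-frame $F$, $\{K^\dagger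 f_i\}_{i=1}^N$ is a $K$-dual, called the canonical $K$-dual. For a $K$-dual $G$ of $F$, $\mathbb{O}_1(F,G):=\max_{1\le i\le N}\|f_i\|\,\|g_i\|$ (the maximum operator norm of the error operators $f\mapsto\langle f,f_i\rangle g_i$). A $K$-dual $G'$ of $F$ is $1$-erasure optimal with respect to the operator norm if $\mathbb{O}_1(F,G')=\inf\{\mathbb{O}_1(F,G):G\text{ is a }K\text{-dual of }F\}$. *)

theory Defs
  imports "HOL-Analysis.Analysis" "Jordan_Normal_Form.Conjugate"
begin

text \<open>
  The common interface of the scalar fields \<open>\<real>\<close> and \<open>\<complex>\<close>; by the theorem of Gelfand and Mazur these
  are, up to isomorphism, its only models.
\<close>

class rc_field = real_normed_field + conjugatable_field +
  assumes mult_conjugate: "x * conjugate x = (norm x)\<^sup>2 *\<^sub>R 1"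

instance real :: rc_field
  by standard (simp add: power2_eq_square)

instance complex :: rc_field
  by standard (simp add: complex_norm_square [symmetric] scaleR_conv_of_real del: of_real_power)

text \<open>
  The inner product is linear in its first argument. Completeness is not required explicitly, as
  it is automatic in finite dimension.
\<close>

locale finite_dim_hilbert_space = vector_space scale
  for scale :: "'k::rc_field \<Rightarrow> 'v::ab_group_add \<Rightarrow> 'v" (infixr \<open>*s\<close> 75) +
  fixes ip :: "'v \<Rightarrow> 'v \<Rightarrow> 'k" and n :: nat
  assumes ip_add_left: "ip (x + y) z = ip x z + ip y z"
    and ip_scale_left: "ip (c *s x) y = c * ip x y"
    and ip_commute: "ip y x = conjugate (ip x y)"
    and ip_nonneg: "\<exists>r\<ge>0. ip x x = of_real r"
    and ip_definite: "ip x x = 0 \<Longrightarrow> x = 0"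
    and dimension: "\<exists>B. finite B \<and> card B = n \<and> independent B \<and> span B = UNIV"
begin

text \<open>The outer norm is that of the scalars: \<open>ip x x\<close> is a nonnegative real, but of type \<^typ>\<open>'k\<close>.\<close>

definition hnorm :: "'v \<Rightarrow> real"
  where "hnorm x = sqrt (norm (ip x x))"

definition bounded_operators :: "('v \<Rightarrow> 'v) set"
  where "bounded_operators =
    {T. Vector_Spaces.linear scale scale T \<and> (\<exists>C. \<forall>x. hnorm (T x) \<le> C * hnorm x)}"

definition adj :: "('v \<Rightarrow> 'v) \<Rightarrow> 'v \<Rightarrow> 'v"
  where "adj T = (THE S. S \<in> bounded_operators \<and> (\<forall>x y. ip (T x) y = ip x (S y)))"

text \<open>The Moore--Penrose pseudoinverse, as the unique solution of the four Penrose equations.\<close>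

definition pinv :: "('v \<Rightarrow> 'v) \<Rightarrow> 'v \<Rightarrow> 'v"
  where "pinv T = (THE S. S \<in> bounded_operators \<and>
    T \<circ> S \<circ> T = T \<and> S \<circ> T \<circ> S = S \<and> adj (T \<circ> S) = T \<circ> S \<and> adj (S \<circ> T) = S \<circ> T)"

text \<open>
  A finite sequence of length \<open>N\<close> is a function on \<open>nat\<close> of which only the values on \<open>{1..N}\<close> matter.
\<close>

definition K_frame :: "('v \<Rightarrow> 'v) \<Rightarrow> nat \<Rightarrow> (nat \<Rightarrow> 'v) \<Rightarrow> bool"
  where "K_frame K N f \<longleftrightarrow>
    (\<exists>A B. 0 < A \<and> A \<le> B \<and>
      (\<forall>x. A * (hnorm (adj K x))\<^sup>2 \<le> (\<Sum>i=1..N. (norm (ip x (f i)))\<^sup>2) \<and>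
           (\<Sum>i=1..N. (norm (ip x (f i)))\<^sup>2) \<le> B * (hnorm x)\<^sup>2))"

definition parseval_K_frame :: "('v \<Rightarrow> 'v) \<Rightarrow> nat \<Rightarrow> (nat \<Rightarrow> 'v) \<Rightarrow> bool"
  where "parseval_K_frame K N f \<longleftrightarrow>
    K_frame K N f \<and> (\<forall>x. (\<Sum>i=1..N. (norm (ip x (f i)))\<^sup>2) = (hnorm (adj K x))\<^sup>2)"

definition K_dual :: "('v \<Rightarrow> 'v) \<Rightarrow> nat \<Rightarrow> (nat \<Rightarrow> 'v) \<Rightarrow> (nat \<Rightarrow> 'v) \<Rightarrow> bool"
  where "K_dual K N f g \<longleftrightarrow> (\<forall>x. K x = (\<Sum>i=1..N. ip x (g i) *s f i))"

definition O1 :: "nat \<Rightarrow> (nat \<Rightarrow> 'v) \<Rightarrow> (nat \<Rightarrow> 'v) \<Rightarrow> real"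
  where "O1 N f g = Max ((\<lambda>i. hnorm (f i) * hnorm (g i)) ` {1..N})"

definition one_erasure_optimal ::
    "('v \<Rightarrow> 'v) \<Rightarrow> nat \<Rightarrow> (nat \<Rightarrow> 'v) \<Rightarrow> (nat \<Rightarrow> 'v) \<Rightarrow> bool"
  where "one_erasure_optimal K N f g \<longleftrightarrow>
    K_dual K N f g \<and> O1 N f g = Inf {O1 N f h | h. K_dual K N f h}"

end

lemma finite_dim_hilbert_space_euclidean:
  "finite_dim_hilbert_space scaleR (inner :: 'a \<Rightarrow> 'a \<Rightarrow> real) DIM('a::euclidean_space)"
proof unfold_locales
  show "\<exists>r\<ge>0. inner x x = of_real r" for x :: 'a
    by (rule exI [of _ "inner x x"]) simp
  show "\<exists>B :: 'a set. finite B \<and> card B = DIM('a) \<and> \<not> module.dependent scaleR B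
      \<and> module.span scaleR B = UNIV"
    by (rule exI [of _ Basis])
      (simp add: independent_Basis [unfolded dependent_raw_def] span_Basis [unfolded span_raw_def])
qed (simp_all add: inner_add_left inner_commute algebra_simps)

lemma finite_dim_hilbert_space_complex:
  "finite_dim_hilbert_space (*s) (\<lambda>x y :: complex ^ 'n. \<Sum>i\<in>UNIV. x $ i * cnj (y $ i)) CARD('n)"
proof unfold_locales
  show "\<exists>r\<ge>0. (\<Sum>i\<in>UNIV. x $ i * cnj (x $ i)) = of_real r" for x :: "complex ^ 'n"
    by (rule exI [of _ "\<Sum>i\<in>UNIV. (norm (x $ i))\<^sup>2"])
      (simp add: sum_nonneg complex_norm_square del: of_real_power)
  show "x = 0" if "(\<Sum>i\<in>UNIV. x $ i * cnj (x $ i)) = 0" for x :: "complex ^ 'n"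
  proof -
    have "complex_of_real (\<Sum>i\<in>UNIV. (norm (x $ i))\<^sup>2) = 0"
      using that by (simp add: complex_norm_square del: of_real_power)
    then have "(\<Sum>i\<in>UNIV. (norm (x $ i))\<^sup>2) = 0"
      by (simp only: of_real_eq_0_iff)
    then show ?thesis
      by (simp add: sum_nonneg_eq_0_iff vec_eq_iff)
  qed
  show "\<exists>B :: (complex ^ 'n) set. finite B \<and> card B = CARD('n) \<and> \<not> vec.dependent B
      \<and> vec.span B = UNIV"
    by (rule exI [of _ cart_basis])
      (simp add: finite_cart_basis card_cart_basis independent_cart_basis span_cart_basis)
qed (simp_all add: algebra_simps sum.distrib sum_distrib_left)

end

theory Submission
  imports Defs
begin

text \<open>
  If \<open>g\<close> is any \<open>K\<close>-dual of \<open>f\<close>, the differences \<open>h i = g i - pinv K (f i)\<close> form a null family: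
  \<open>\<Sum>i. ip x (h i) *s f i = 0\<close> for every \<open>x\<close>. Since \<open>V1\<close> and \<open>V2\<close> meet only in \<open>0\<close>, the part of this
  relation indexed by \<open>I1\<close> vanishes by itself (\<open>relation_splits\<close>), and it still vanishes after
  applying \<open>pinv K\<close>. So the operator \<open>x \<mapsto> \<Sum>i\<in>I1. ip x (h i) *s pinv K (f i)\<close> is zero, and so is its
  trace \<open>\<Sum>i\<in>I1. ip (pinv K (f i)) (h i)\<close> (\<open>trace_of_zero_operator\<close>).

  If the vectors \<open>g i = pinv K (f i) + h i\<close> were shorter than \<open>pinv K (f i)\<close> for all \<open>i\<close> in \<open>I1\<close>,
  every term of that trace would have negative real part, which is impossible
  (\<open>exists_norm_add_ge\<close>). Hence some \<open>i\<close> in \<open>I1\<close> satisfies \<open>hnorm (pinv K (f i)) \<le> hnorm (g i)\<close>, and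
  for this \<open>i\<close> the product \<open>hnorm (f i) * hnorm (g i)\<close> is at least the maximum \<open>L\<close> attained by the
  canonical dual.

  That \<open>pinv K \<circ> f\<close> is a \<open>K\<close>-dual at all comes from the Parseval condition, which by polarization
  says that the frame operator is \<open>K \<circ> adj K\<close> (\<open>parseval_K_frame_operator\<close>); composing with
  \<open>adj (pinv K)\<close> gives \<open>K \<circ> adj (pinv K \<circ> K) = K \<circ> pinv K \<circ> K = K\<close>.

  Adjoints and pseudoinverses are given by definite description, so their existence and uniqueness
  have to be established as well. Both rest on an orthonormal basis, which also shows that every
  linear operator is bounded.
\<close>

section \<open>Scalars\<close>

lemma conjugate_of_real_rc [simp]: "conjugate (of_real r :: 'k::rc_field) = of_real r"
proof (cases "r = 0")
  case False
  have "of_real r * conjugate (of_real r :: 'k) = of_real r * of_real r"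
    using mult_conjugate [of "of_real r :: 'k"]
    by (simp add: power2_eq_square scaleR_conv_of_real)
  with False show ?thesis by simp
qed simp

lemma mult_conjugate_of_real:
  "(x :: 'k::rc_field) * conjugate x = of_real ((norm x)\<^sup>2)"
  using mult_conjugate [of x] by (simp add: scaleR_conv_of_real)

text \<open>The symbol \<open>*s\<close> is reserved for the scalar multiplication of the Hilbert space.\<close>

no_notation vector_scalar_mult (infixl \<open>*s\<close> 70)

context finite_dim_hilbert_space
begin

abbreviation lin :: "('v \<Rightarrow> 'v) \<Rightarrow> bool"
  where "lin \<equiv> Vector_Spaces.linear (*s) (*s)"

section \<open>Inner product calculus\<close>

lemma linI:
  assumes "\<And>x y. T (x + y) = T x + T y" and "\<And>c x. T (c *s x) = c *s T x"
  shows "lin T"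
  using assms vector_space_axioms by (simp add: Vector_Spaces.linear_iff)

lemma lin_add: "lin T \<Longrightarrow> T (x + y) = T x + T y"
  and lin_scale: "lin T \<Longrightarrow> T (c *s x) = c *s T x"
  by (simp_all add: Vector_Spaces.linear_iff)

lemma lin_zero: "lin T \<Longrightarrow> T 0 = 0"
  using lin_add [of T 0 0] by simp

lemma lin_diff: "lin T \<Longrightarrow> T (x - y) = T x - T y"
  using lin_add [of T "x - y" y] by (simp add: algebra_simps)

lemma lin_sum: "lin T \<Longrightarrow> T (\<Sum>i\<in>I. a i) = (\<Sum>i\<in>I. T (a i))"
  by (induction I rule: infinite_finite_induct) (simp_all add: lin_add lin_zero)

lemma lin_compose: "lin S \<Longrightarrow> lin T \<Longrightarrow> lin (S \<circ> T)"
  by (rule linI) (simp_all add: lin_add lin_scale)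

lemma ip_add_right: "ip x (y + z) = ip x y + ip x z"
  using ip_commute [of x "y + z"] ip_commute [of x y] ip_commute [of x z]
  by (simp add: ip_add_left conjugate_dist_add)

lemma ip_scale_right: "ip x (c *s y) = conjugate c * ip x y"
  using ip_commute [of x "c *s y"] ip_commute [of x y]
  by (simp add: ip_scale_left conjugate_dist_mul)

lemma ip_zero_left [simp]: "ip 0 x = 0"
  using ip_add_left [of 0 0 x] by simp

lemma ip_zero_right [simp]: "ip x 0 = 0"
  using ip_add_right [of x 0 0] by simp

lemma ip_diff_left: "ip (x - y) z = ip x z - ip y z"
  using ip_add_left [of "x - y" y z] by (simp add: algebra_simps)

lemma ip_diff_right: "ip x (y - z) = ip x y - ip x z"
  using ip_add_right [of x "y - z" z] by (simp add: algebra_simps)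

lemma ip_sum_left: "ip (\<Sum>i\<in>I. a i) x = (\<Sum>i\<in>I. ip (a i) x)"
  by (induction I rule: infinite_finite_induct) (simp_all add: ip_add_left)

lemma ip_sum_right: "ip x (\<Sum>i\<in>I. a i) = (\<Sum>i\<in>I. ip x (a i))"
  by (induction I rule: infinite_finite_induct) (simp_all add: ip_add_right)

lemma ip_ext_right: "(\<And>z. ip z x = ip z y) \<Longrightarrow> x = y"
  using ip_definite [of "x - y"] by (simp add: ip_diff_right)

lemma ip_mult_swap: "ip x y * ip y x = of_real ((norm (ip x y))\<^sup>2)"
  using mult_conjugate_of_real [of "ip x y"] by (simp add: ip_commute [of y x, symmetric])

lemma ip_self: "ip x x = of_real ((hnorm x)\<^sup>2)"
proof -
  obtain r where "r \<ge> 0" "ip x x = of_real r"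
    using ip_nonneg by blast
  then show ?thesis by (simp add: hnorm_def)
qed

lemma hnorm_nonneg [simp]: "hnorm x \<ge> 0"
  by (simp add: hnorm_def)

section \<open>Orthonormal bases\<close>

definition orthonormal :: "'v set \<Rightarrow> bool"
  where "orthonormal E \<longleftrightarrow> (\<forall>d\<in>E. \<forall>e\<in>E. ip d e = (if d = e then 1 else 0))"

lemma orthonormal_expansion:
  assumes "finite E" "orthonormal E" "x \<in> span E"
  shows "x = (\<Sum>e\<in>E. ip x e *s e)"
  using assms(3)
proof (induction rule: span_induct_alt)
  case (step c d y)
  have "(\<Sum>e\<in>E. ip d e *s e) = (\<Sum>e\<in>E. if d = e then e else 0)"
    using assms(2) step(1) by (intro sum.cong) (auto simp: orthonormal_def)
  also have "\<dots> = d"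
    using assms(1) step(1) by simp
  finally have "(\<Sum>e\<in>E. (c * ip d e) *s e) = c *s d"
    by (simp flip: scale_scale scale_sum_right)
  with step show ?case
    by (simp add: ip_add_left ip_scale_left scale_left_distrib sum.distrib)
qed simp

text \<open>
  Gram--Schmidt: a new vector is replaced by its normalized component orthogonal to the vectors
  found so far, unless that component is zero.
\<close>

lemma gram_schmidt:
  assumes "finite B"
  shows "\<exists>E. finite E \<and> orthonormal E \<and> B \<subseteq> span E"
  using assms
proof induction
  case empty
  show ?case by (rule exI [of _ "{}"]) (simp add: orthonormal_def)
next
  case (insert b B)
  then obtain E where E: "finite E" "orthonormal E" "B \<subseteq> span E" by blast
  define p where "p = (\<Sum>e\<in>E. ip b e *s e)"
  have p: "p \<in> span E"
    unfolding p_def by (intro span_sum span_scale span_base)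
  have orth: "ip (b - p) d = 0" if "d \<in> E" for d
  proof -
    have "ip p d = (\<Sum>e\<in>E. if e = d then ip b e else 0)"
      unfolding p_def ip_sum_left using E(2) that
      by (intro sum.cong) (auto simp: ip_scale_left orthonormal_def)
    also have "\<dots> = ip b d"
      using E(1) that by simp
    finally show ?thesis by (simp add: ip_diff_left)
  qed
  show ?case
  proof (cases "b = p")
    case True
    with E p show ?thesis by auto
  next
    case False
    define c :: 'k where "c = of_real (1 / hnorm (b - p))"
    define u where "u = c *s (b - p)"
    have nz: "hnorm (b - p) \<noteq> 0"
      using ip_definite [of "b - p"] ip_self [of "b - p"] False by auto
    then have "c \<noteq> 0" by (simp add: c_def)
    have real: "conjugate c = c" unfolding c_def by (rule conjugate_of_real_rc)
    have unit: "ip u u = 1"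
      unfolding u_def ip_scale_left ip_scale_right real ip_self [of "b - p"]
      using nz by (simp add: c_def power2_eq_square)
    have uE: "ip u d = 0" "ip d u = 0" if "d \<in> E" for d
      using orth [OF that] ip_commute [of d u]
      by (simp_all add: u_def ip_scale_left)
    have on: "orthonormal (insert u E)"
      using E(2) unit uE by (auto simp: orthonormal_def)
    have sub: "span E \<subseteq> span (insert u E)"
      by (rule span_mono) auto
    have "(1 / c) *s u + p \<in> span (insert u E)"
      using p sub by (intro span_add [OF span_scale [OF span_base]]) auto
    moreover have "(1 / c) *s u + p = b"
      using \<open>c \<noteq> 0\<close> by (simp add: u_def)
    ultimately have "insert b B \<subseteq> span (insert u E)"
      using E(3) sub by auto
    with E(1) on show ?thesis by blast
  qed
qed

lemma orthonormal_basis: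
  obtains E where "finite E" "orthonormal E" "\<And>x. x = (\<Sum>e\<in>E. ip x e *s e)"
proof -
  obtain B where "finite B" "span B = UNIV"
    using dimension by blast
  moreover from this obtain E where E: "finite E" "orthonormal E" "B \<subseteq> span E"
    using gram_schmidt by blast
  ultimately have "span E = UNIV"
    using span_minimal [of B "span E"] by auto
  with E that orthonormal_expansion show ?thesis by blast
qed

lemma parseval_identity:
  assumes "\<And>x. x = (\<Sum>e\<in>E. ip x e *s e)"
  shows "ip x y = (\<Sum>e\<in>E. ip x e * ip e y)"
  by (subst assms [of x]) (simp add: ip_sum_left ip_scale_left)

lemma hnorm_expansion:
  assumes "\<And>x. x = (\<Sum>e\<in>E. ip x e *s e)"
  shows "(hnorm x)\<^sup>2 = (\<Sum>e\<in>E. (norm (ip x e))\<^sup>2)"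
proof -
  have "(of_real ((hnorm x)\<^sup>2) :: 'k) = of_real (\<Sum>e\<in>E. (norm (ip x e))\<^sup>2)"
    using parseval_identity [OF assms, of x x]
    by (simp only: ip_self [symmetric] ip_mult_swap of_real_sum)
  then show ?thesis unfolding of_real_eq_iff .
qed

text \<open>
  Each coordinate of \<open>x\<close> is at most \<open>hnorm x\<close>, so in an orthonormal basis the coordinates of
  \<open>T x\<close> are bounded by \<open>hnorm x\<close> times absolute row sums of the matrix of \<open>T\<close>.
\<close>

lemma bounded_operators_eq: "bounded_operators = {T. lin T}"
proof -
  have "\<exists>C. \<forall>x. hnorm (T x) \<le> C * hnorm x" if T: "lin T" for T
  proof -
    obtain E where E: "finite E" "\<And>x. x = (\<Sum>e\<in>E. ip x e *s e)"
      using orthonormal_basis by metis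
    define C where "C = (\<Sum>d\<in>E. (\<Sum>e\<in>E. norm (ip (T e) d))\<^sup>2)"
    have "hnorm (T x) \<le> sqrt C * hnorm x" for x
    proof -
      have coeff: "norm (ip x e) \<le> hnorm x" if "e \<in> E" for e
      proof (rule power2_le_imp_le)
        show "(norm (ip x e))\<^sup>2 \<le> (hnorm x)\<^sup>2"
          unfolding hnorm_expansion [OF E(2), of x] using E(1) that
          by (intro member_le_sum) auto
      qed simp
      have "norm (ip (T x) d) \<le> (\<Sum>e\<in>E. norm (ip (T e) d)) * hnorm x" for d
      proof -
        have "ip (T x) d = (\<Sum>e\<in>E. ip x e * ip (T e) d)"
          by (subst E(2) [of x]) (simp add: lin_sum lin_scale T ip_sum_left ip_scale_left)
        also have "norm \<dots> \<le> (\<Sum>e\<in>E. norm (ip (T e) d) * hnorm x)"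
          using coeff
          by (intro sum_norm_le) (simp add: norm_mult mult.commute [of _ "hnorm x"] mult_right_mono)
        finally show ?thesis by (simp add: sum_distrib_right)
      qed
      then have coord: "(norm (ip (T x) d))\<^sup>2 \<le> ((\<Sum>e\<in>E. norm (ip (T e) d)) * hnorm x)\<^sup>2" for d
        by (intro power_mono) auto
      have "(hnorm (T x))\<^sup>2 \<le> C * (hnorm x)\<^sup>2"
        unfolding hnorm_expansion [OF E(2), of "T x"] C_def sum_distrib_right
        using coord by (intro sum_mono) (simp add: power_mult_distrib)
      then have "sqrt ((hnorm (T x))\<^sup>2) \<le> sqrt (C * (hnorm x)\<^sup>2)"
        by (rule real_sqrt_le_mono)
      then show ?thesis by (simp add: real_sqrt_mult)
    qed
    then show ?thesis by blast
  qed
  then show ?thesis by (auto simp: bounded_operators_def)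
qed

section \<open>Adjoints\<close>

lemma adjoint_exists:
  assumes T: "lin T"
  shows "\<exists>S. lin S \<and> (\<forall>x y. ip (T x) y = ip x (S y))"
proof -
  obtain E where E: "\<And>x. x = (\<Sum>e\<in>E. ip x e *s e)"
    using orthonormal_basis by metis
  define S where "S y = (\<Sum>e\<in>E. ip y (T e) *s e)" for y
  have "lin S"
    by (rule linI) (simp_all add: S_def ip_add_left ip_scale_left scale_left_distrib
        sum.distrib scale_sum_right)
  moreover have "ip (T x) y = ip x (S y)" for x y
  proof -
    have "ip (T x) y = (\<Sum>e\<in>E. ip x e * ip (T e) y)"
      by (subst E [of x]) (simp add: lin_sum lin_scale T ip_sum_left ip_scale_left)
    also have "\<dots> = ip x (S y)"
      unfolding S_def ip_sum_right ip_scale_right ip_commute [of _ y, symmetric]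
      by (simp add: mult.commute)
    finally show ?thesis .
  qed
  ultimately show ?thesis by blast
qed

lemma adj_eqI:
  assumes "lin S" "\<And>x y. ip (T x) y = ip x (S y)"
  shows "adj T = S"
  unfolding adj_def bounded_operators_eq
proof (rule the_equality)
  fix R assume "R \<in> {T. lin T} \<and> (\<forall>x y. ip (T x) y = ip x (R y))"
  then have "ip x (R y) = ip x (S y)" for x y
    using assms(2) by metis
  then show "R = S" by (intro ext ip_ext_right)
qed (use assms in auto)

lemma
  assumes "lin T"
  shows lin_adj: "lin (adj T)"
    and ip_adj_right: "ip x (adj T y) = ip (T x) y"
  using adjoint_exists [OF assms] adj_eqI [of _ T] by auto

lemma ip_adj_left: "lin T \<Longrightarrow> ip (adj T x) y = ip x (T y)"
  using ip_adj_right [of T y x] by (metis ip_commute)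

lemma adj_adj: "lin T \<Longrightarrow> adj (adj T) = T"
  by (rule adj_eqI) (auto simp: ip_adj_left)

lemma adj_compose: "lin S \<Longrightarrow> lin T \<Longrightarrow> adj (S \<circ> T) = adj T \<circ> adj S"
  by (rule adj_eqI) (auto simp: lin_compose lin_adj ip_adj_right)

section \<open>The Moore--Penrose pseudoinverse\<close>

lemma generalized_inverse_exists:
  assumes T: "lin T"
  shows "\<exists>G. lin G \<and> (\<forall>x. T (G (T x)) = T x)"
proof -
  interpret vector_space_pair "(*s)" "(*s)" ..
  show ?thesis
    using linear_exists_right_inverse_on [OF T subspace_UNIV] by auto
qed

text \<open>
  The witness is \<open>X = G \<circ> adj T\<close> with \<open>G\<close> a generalized inverse of the normal operator
  \<open>adj T \<circ> T\<close>; then \<open>X\<close> solves least squares problems and \<open>T \<circ> X\<close> is the orthogonal projection onto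
  the range of \<open>T\<close>.
\<close>

lemma hermitian_generalized_inverse_exists:
  assumes T: "lin T"
  shows "\<exists>X. lin X \<and> T \<circ> X \<circ> T = T \<and> adj (T \<circ> X) = T \<circ> X"
proof -
  note T' = lin_adj [OF T]
  obtain G where G: "lin G"
    and inv: "\<And>x. adj T (T (G (adj T (T x)))) = adj T (T x)"
    using generalized_inverse_exists [OF lin_compose [OF T' T]] by auto
  define X where "X = G \<circ> adj T"
  have X: "lin X" unfolding X_def using G T' by (rule lin_compose)
  have TXT: "T (X (T x)) = T x" for x
  proof -
    define y where "y = X (T x) - x"
    have "adj T (T y) = 0"
      by (simp add: y_def X_def lin_diff T T' inv)
    then have "ip (T y) (T y) = 0"
      by (simp flip: ip_adj_right [OF T])
    then have "T y = 0" by (rule ip_definite)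
    then show ?thesis by (simp add: y_def lin_diff T)
  qed
  let ?P = "T \<circ> X" and ?Q = "adj (T \<circ> X)"
  have P: "lin ?P" using T X by (rule lin_compose)
  have Q: "lin ?Q" using P by (rule lin_adj)
  \<comment> \<open>\<open>?P\<close> fixes the range of \<open>T\<close>, which contains the range of \<open>?Q\<close>. Hence \<open>?P \<circ> ?Q = ?Q\<close>, so \<open>?Q\<close>
    has the form \<open>adj ?Q \<circ> ?Q\<close> and is self-adjoint.\<close>
  have "?Q = T \<circ> (adj G \<circ> adj T)"
    by (simp add: X_def adj_compose lin_compose T T' G adj_adj lin_adj comp_assoc)
  then have PQ: "?P (?Q x) = ?Q x" for x
    using TXT by simp
  have Q_ip: "ip (?Q x) y = ip (?Q x) (?Q y)" for x y
    using ip_adj_right [OF P, of "?Q x" y] PQ by simp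
  have "ip (?Q x) y = ip x (?Q y)" for x y
    using Q_ip [of x y] Q_ip [of y x] by (metis ip_commute)
  with Q have "adj ?Q = ?Q" by (rule adj_eqI)
  with adj_adj [OF P] have "adj ?P = ?P" by simp
  with X TXT show ?thesis by (intro exI [of _ X]) (auto simp: fun_eq_iff)
qed

text \<open>
  Writing \<open>T \<circ> R = (T \<circ> S) \<circ> (T \<circ> R)\<close> and taking adjoints swaps the two self-adjoint factors,
  which gives \<open>T \<circ> R = T \<circ> S\<close>; symmetrically \<open>R \<circ> T = S \<circ> T\<close>.
\<close>

lemma penrose_unique:
  assumes T: "lin T" and R: "lin R" and S: "lin S"
    and R_eqs: "T \<circ> R \<circ> T = T" "R \<circ> T \<circ> R = R" "adj (T \<circ> R) = T \<circ> R" "adj (R \<circ> T) = R \<circ> T"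
    and S_eqs: "T \<circ> S \<circ> T = T" "S \<circ> T \<circ> S = S" "adj (T \<circ> S) = T \<circ> S" "adj (S \<circ> T) = S \<circ> T"
  shows "R = S"
proof -
  note lins = T R S lin_compose
  have "T \<circ> R = (T \<circ> S) \<circ> (T \<circ> R)"
    using S_eqs(1) by (metis comp_assoc)
  then have "adj (T \<circ> R) = adj ((T \<circ> S) \<circ> (T \<circ> R))" by simp
  also have "\<dots> = (T \<circ> R) \<circ> (T \<circ> S)"
    using R_eqs(3) S_eqs(3) by (simp add: adj_compose [of "T \<circ> S" "T \<circ> R"] lins)
  also have "\<dots> = T \<circ> S"
    using R_eqs(1) by (metis comp_assoc)
  finally have TR: "T \<circ> R = T \<circ> S" using R_eqs(3) by simp
  have "R \<circ> T = (R \<circ> T) \<circ> (S \<circ> T)"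
    using S_eqs(1) by (metis comp_assoc)
  then have "adj (R \<circ> T) = adj ((R \<circ> T) \<circ> (S \<circ> T))" by simp
  also have "\<dots> = (S \<circ> T) \<circ> (R \<circ> T)"
    using R_eqs(4) S_eqs(4) by (simp add: adj_compose [of "R \<circ> T" "S \<circ> T"] lins)
  also have "\<dots> = S \<circ> T"
    using R_eqs(1) by (metis comp_assoc)
  finally have RT: "R \<circ> T = S \<circ> T" using R_eqs(4) by simp
  have "R = S \<circ> T \<circ> R" using R_eqs(2) RT by simp
  also have "\<dots> = S" using TR S_eqs(2) by (simp add: comp_assoc)
  finally show ?thesis .
qed

text \<open>
  Urquhart's formula: if \<open>X\<close> and \<open>Y\<close> are generalized inverses of \<open>T\<close> with \<open>T \<circ> X\<close> and \<open>Y \<circ> T\<close>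
  self-adjoint, then \<open>Y \<circ> T \<circ> X\<close> is the pseudoinverse. Taking adjoints turns a generalized inverse
  \<open>Z\<close> of \<open>adj T\<close> with \<open>adj T \<circ> Z\<close> self-adjoint into such a \<open>Y\<close>.
\<close>

lemma penrose_exists:
  assumes T: "lin T"
  shows "\<exists>S. lin S \<and> T \<circ> S \<circ> T = T \<and> S \<circ> T \<circ> S = S \<and>
    adj (T \<circ> S) = T \<circ> S \<and> adj (S \<circ> T) = S \<circ> T"
proof -
  obtain X where X: "lin X" "T \<circ> X \<circ> T = T" "adj (T \<circ> X) = T \<circ> X"
    using hermitian_generalized_inverse_exists [OF T] by blast
  obtain Z where Z: "lin Z" "adj T \<circ> Z \<circ> adj T = adj T" "adj (adj T \<circ> Z) = adj T \<circ> Z"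
    using hermitian_generalized_inverse_exists [OF lin_adj [OF T]] by blast
  define Y where "Y = adj Z"
  note lins = T X(1) Z(1) lin_adj lin_compose
  have Y: "lin Y" by (simp add: Y_def lins)
  have YT: "Y \<circ> T = adj T \<circ> Z"
    using Z(3) by (simp add: Y_def adj_compose adj_adj lins)
  have "adj (adj T \<circ> Z \<circ> adj T) = adj (adj T)" by (simp only: Z(2))
  then have TYT: "T \<circ> Y \<circ> T = T"
    by (simp add: Y_def adj_compose adj_adj lins comp_assoc)
  define S where "S = Y \<circ> T \<circ> X"
  have TS: "T \<circ> S = T \<circ> X"
    using TYT by (metis S_def comp_assoc)
  have ST: "S \<circ> T = Y \<circ> T"
    using X(2) by (metis S_def comp_assoc)
  have "lin S" by (simp add: S_def lins Y)
  moreover have "T \<circ> S \<circ> T = T" using TS X(2) by simp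
  moreover have "S \<circ> T \<circ> S = S"
    using ST TS by (metis S_def comp_assoc)
  moreover have "adj (T \<circ> S) = T \<circ> S" using TS X(3) by simp
  moreover have "adj (S \<circ> T) = S \<circ> T" using ST YT Z(3) by simp
  ultimately show ?thesis by blast
qed

lemma
  assumes T: "lin T"
  shows lin_pinv: "lin (pinv T)"
    and pinv_inverse: "T \<circ> pinv T \<circ> T = T"
    and adj_pinv_comp: "adj (pinv T \<circ> T) = pinv T \<circ> T"
proof -
  let ?P = "\<lambda>S. S \<in> bounded_operators \<and>
    T \<circ> S \<circ> T = T \<and> S \<circ> T \<circ> S = S \<and> adj (T \<circ> S) = T \<circ> S \<and> adj (S \<circ> T) = S \<circ> T"
  have "\<exists>!S. ?P S"
    using penrose_exists [OF T] penrose_unique [OF T]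
    unfolding bounded_operators_eq mem_Collect_eq by (intro ex_ex1I) blast+
  then have "?P (pinv T)"
    unfolding pinv_def by (rule theI')
  then show "lin (pinv T)" "T \<circ> pinv T \<circ> T = T" "adj (pinv T \<circ> T) = pinv T \<circ> T"
    by (auto simp: bounded_operators_eq)
qed

section \<open>The canonical dual of a Parseval frame\<close>

text \<open>
  Evaluating the form at \<open>x + D x\<close> makes the cross terms add up to \<open>2 * ip (D x) (D x)\<close>. This form of
  polarization is the same for real and complex scalars; over the reals the symmetry of \<open>D\<close> is
  essential.
\<close>

lemma hermitian_quadratic_form_zero:
  assumes D: "lin D" "\<And>x y. ip (D x) y = ip x (D y)" and zero: "\<And>x. ip (D x) x = 0"
  shows "D x = 0"
proof -
  have "0 = ip (D (x + D x)) (x + D x)"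
    using zero by simp
  also have "\<dots> = 2 * ip (D x) (D x)"
    using D(2) [of "D x" x] zero by (simp add: lin_add D(1) ip_add_left ip_add_right)
  finally show ?thesis by (simp add: ip_definite)
qed

text \<open>
  The Parseval condition says that the frame operator and \<open>K \<circ> adj K\<close> have the same quadratic form;
  both are self-adjoint, so they agree.
\<close>

lemma parseval_K_frame_operator:
  assumes K: "lin K" and F: "parseval_K_frame K N f"
  shows "(\<Sum>i=1..N. ip x (f i) *s f i) = K (adj K x)"
proof -
  define D where "D x = (\<Sum>i=1..N. ip x (f i) *s f i) - K (adj K x)" for x
  note K' = lin_adj [OF K]
  have lin: "lin D"
    by (rule linI) (simp_all add: D_def ip_add_left ip_scale_left scale_left_distrib sum.distrib
        scale_sum_right scale_right_diff_distrib lin_add lin_scale K K')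
  have left: "ip (D x) y = (\<Sum>i=1..N. ip x (f i) * ip (f i) y) - ip (adj K x) (adj K y)" for x y
    by (simp add: D_def ip_diff_left ip_sum_left ip_scale_left ip_adj_right K)
  have right: "ip x (D y) = (\<Sum>i=1..N. ip x (f i) * ip (f i) y) - ip (adj K x) (adj K y)" for x y
    by (simp add: D_def ip_diff_right ip_sum_right ip_scale_right ip_adj_left K
        ip_commute [of _ y, symmetric] mult.commute)
  have zero: "ip (D x) x = 0" for x
  proof -
    have "(\<Sum>i=1..N. (norm (ip x (f i)))\<^sup>2) = (hnorm (adj K x))\<^sup>2"
      using F by (simp add: parseval_K_frame_def)
    then show ?thesis
      unfolding left ip_mult_swap ip_self of_real_sum [symmetric] by simp
  qed
  have "D x = 0"
    by (rule hermitian_quadratic_form_zero [OF lin _ zero]) (simp add: left right)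
  then show ?thesis by (simp add: D_def)
qed

text \<open>
  The sum to be computed is the frame operator \<open>K \<circ> adj K\<close> applied to \<open>adj (pinv K) x\<close>, and
  \<open>adj K \<circ> adj (pinv K)\<close> is the adjoint of the self-adjoint projection \<open>pinv K \<circ> K\<close>.
\<close>

lemma canonical_K_dual:
  assumes K: "lin K" and F: "parseval_K_frame K N f"
  shows "K_dual K N f (\<lambda>i. pinv K (f i))"
  unfolding K_dual_def
proof
  fix x
  note P = lin_pinv [OF K]
  have "(\<Sum>i=1..N. ip x (pinv K (f i)) *s f i) = K (adj K (adj (pinv K) x))"
    using parseval_K_frame_operator [OF K F, of "adj (pinv K) x"]
    by (simp add: ip_adj_left P)
  also have "adj K (adj (pinv K) x) = pinv K (K x)"
    using adj_pinv_comp [OF K] by (simp add: adj_compose P K fun_eq_iff)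
  also have "K (pinv K (K x)) = K x"
    using pinv_inverse [OF K] by (simp add: fun_eq_iff)
  finally show "K x = (\<Sum>i=1..N. ip x (pinv K (f i)) *s f i)" ..
qed

section \<open>Optimality\<close>

text \<open>
  The conclusion is about the trace of the operator \<open>x \<mapsto> \<Sum>i\<in>I. ip x (h i) *s a i\<close>, computed as
  the sum of its diagonal entries in an orthonormal basis.
\<close>

lemma trace_of_zero_operator:
  assumes "\<And>x. (\<Sum>i\<in>I. ip x (h i) *s a i) = 0"
  shows "(\<Sum>i\<in>I. ip (a i) (h i)) = 0"
proof -
  obtain E where E: "\<And>x. x = (\<Sum>e\<in>E. ip x e *s e)"
    using orthonormal_basis by metis
  have "(\<Sum>i\<in>I. ip (a i) (h i)) = (\<Sum>i\<in>I. \<Sum>e\<in>E. ip (a i) e * ip e (h i))"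
    by (intro sum.cong refl parseval_identity E)
  also have "\<dots> = (\<Sum>e\<in>E. ip (\<Sum>i\<in>I. ip e (h i) *s a i) e)"
    by (subst sum.swap) (simp add: ip_sum_left ip_scale_left mult.commute)
  also have "\<dots> = 0"
    by (simp add: assms)
  finally show ?thesis .
qed

text \<open>
  If \<open>a i + h i\<close> is shorter than \<open>a i\<close>, then \<open>ip (a i) (h i)\<close> has negative real part, and numbers
  with negative real part do not add up to zero.
\<close>

lemma exists_norm_add_ge:
  assumes I: "finite I" "I \<noteq> {}" and zero: "(\<Sum>i\<in>I. ip (a i) (h i)) = 0"
  shows "\<exists>i\<in>I. hnorm (a i) \<le> hnorm (a i + h i)"
proof (rule ccontr)
  assume "\<not> ?thesis"
  then have less: "hnorm (a i + h i) < hnorm (a i)" if "i \<in> I" for i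
    using that by force
  \<comment> \<open>\<open>r i\<close> is twice the real part of \<open>ip (a i) (h i)\<close>, obtained from norms because a
    real part is not part of the common structure of the scalar fields.\<close>
  define r where "r i = (hnorm (a i + h i))\<^sup>2 - (hnorm (a i))\<^sup>2 - (hnorm (h i))\<^sup>2" for i
  have r: "of_real (r i) = ip (a i) (h i) + ip (h i) (a i)" for i
    unfolding r_def of_real_diff ip_self [symmetric]
    by (simp add: ip_add_left ip_add_right)
  have "(\<Sum>i\<in>I. ip (h i) (a i)) = conjugate (\<Sum>i\<in>I. ip (a i) (h i))"
    by (simp add: sum_conjugate I(1) flip: ip_commute)
  with zero have "(of_real (\<Sum>i\<in>I. r i) :: 'k) = 0"
    by (simp add: r sum.distrib)
  then have "(\<Sum>i\<in>I. r i) = 0"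
    by (simp only: of_real_eq_0_iff)
  moreover have "(\<Sum>i\<in>I. r i) < (\<Sum>i\<in>I. 0)"
  proof (rule sum_strict_mono)
    fix i assume "i \<in> I"
    then have "(hnorm (a i + h i))\<^sup>2 < (hnorm (a i))\<^sup>2"
      using less by (intro power_strict_mono) auto
    then show "r i < 0"
      unfolding r_def using zero_le_power2 [of "hnorm (h i)"] by linarith
  qed (use I in auto)
  ultimately show False by simp
qed

lemma relation_splits:
  assumes fin: "finite I" "finite J" and disj: "I \<inter> J = {}"
    and indep: "span (f ` I) \<inter> span (f ` J) = {0}"
    and zero: "(\<Sum>i\<in>I \<union> J. c i *s f i) = 0"
  shows "(\<Sum>i\<in>I. c i *s f i) = 0"
proof -
  have in_span: "(\<Sum>i\<in>A. c i *s f i) \<in> span (f ` A)" for A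
    by (intro span_sum span_scale span_base) auto
  have "(\<Sum>i\<in>I. c i *s f i) = - (\<Sum>i\<in>J. c i *s f i)"
    using zero fin disj by (simp add: sum.union_disjoint eq_neg_iff_add_eq_0)
  also have "\<dots> \<in> span (f ` J)"
    using in_span by (rule span_neg)
  finally show ?thesis
    using in_span indep by blast
qed

text \<open>
  The comparison of duals behind optimality: whatever the other dual does, on an index set whose
  frame vectors are independent of the rest it cannot shorten all vectors of a dual that is a linear
  image of the frame. Linearity of \<open>P\<close> is what carries the relation between the \<open>f i\<close> over to the
  \<open>P (f i)\<close>, so that the trace pairs them with the differences.
\<close>

lemma K_dual_norm_ge:
  assumes P: "lin P" and duals: "K_dual K N f (\<lambda>i. P (f i))" "K_dual K N f g"
    and I: "I \<subseteq> {1..N}" "I \<noteq> {}"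
    and indep: "span (f ` I) \<inter> span (f ` ({1..N} - I)) = {0}"
  shows "\<exists>i\<in>I. hnorm (P (f i)) \<le> hnorm (g i)"
proof -
  have fin: "finite I" using I(1) by (rule finite_subset) simp
  define h where "h i = g i - P (f i)" for i
  have "(\<Sum>i\<in>I. ip x (h i) *s P (f i)) = 0" for x
  proof -
    have "(\<Sum>i=1..N. ip x (h i) *s f i) = K x - K x"
      using duals unfolding K_dual_def h_def ip_diff_right scale_left_diff_distrib sum_subtractf
      by metis
    moreover have "I \<union> ({1..N} - I) = {1..N}" using I(1) by auto
    ultimately have "(\<Sum>i\<in>I. ip x (h i) *s f i) = 0"
      using relation_splits [of I "{1..N} - I" f "\<lambda>i. ip x (h i)"] fin indep by simp
    then have "P (\<Sum>i\<in>I. ip x (h i) *s f i) = 0"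
      by (simp add: lin_zero P)
    then show ?thesis by (simp add: lin_sum lin_scale P)
  qed
  then have "(\<Sum>i\<in>I. ip (P (f i)) (h i)) = 0"
    by (rule trace_of_zero_operator)
  from exists_norm_add_ge [OF fin I(2) this] show ?thesis
    by (simp add: h_def)
qed

lemma canonical_dual_optimal:
  assumes N: "N \<ge> 1" and K: "lin K" and F: "parseval_K_frame K N f"
    and I: "I = {i \<in> {1..N}. hnorm (f i) * hnorm (pinv K (f i)) = O1 N f (\<lambda>i. pinv K (f i))}"
    and indep: "span (f ` I) \<inter> span (f ` ({1..N} - I)) = {0}"
  shows "one_erasure_optimal K N f (\<lambda>i. pinv K (f i))"
proof -
  let ?L = "O1 N f (\<lambda>i. pinv K (f i))"
  note dual = canonical_K_dual [OF K F]
  have "?L \<in> (\<lambda>i. hnorm (f i) * hnorm (pinv K (f i))) ` {1..N}"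
    unfolding O1_def using N by (intro Max_in) auto
  then have "I \<noteq> {}" unfolding I by auto
  have le: "?L \<le> O1 N f g" if g: "K_dual K N f g" for g
  proof -
    obtain i where i: "i \<in> I" "hnorm (pinv K (f i)) \<le> hnorm (g i)"
      using K_dual_norm_ge [OF lin_pinv [OF K] dual g _ \<open>I \<noteq> {}\<close> indep] I by blast
    then have "?L = hnorm (f i) * hnorm (pinv K (f i))"
      unfolding I by simp
    also have "\<dots> \<le> hnorm (f i) * hnorm (g i)"
      using i(2) by (intro mult_left_mono) auto
    also have "\<dots> \<le> O1 N f g"
      unfolding O1_def using i(1) I by (intro Max_ge) auto
    finally show ?thesis .
  qed
  have "Inf {O1 N f h | h. K_dual K N f h} = ?L"
    using dual le by (intro cInf_eq_minimum) auto
  with dual show ?thesis by (simp add: one_erasure_optimal_def)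
qed

end

theorem proposition4p1:
  fixes scale :: "'k::rc_field \<Rightarrow> 'v::ab_group_add \<Rightarrow> 'v"
    and ip :: "'v \<Rightarrow> 'v \<Rightarrow> 'k"
    and n N :: nat
    and K :: "'v \<Rightarrow> 'v"
    and f :: "nat \<Rightarrow> 'v"
    and L :: real and I1 I2 :: "nat set" and V1 V2 :: "'v set"
  assumes "finite_dim_hilbert_space scale ip n"
    and "N \<ge> 1"
    and "K \<in> finite_dim_hilbert_space.bounded_operators scale ip"
    and "finite_dim_hilbert_space.parseval_K_frame scale ip K N f"
    and "L = Max {finite_dim_hilbert_space.hnorm ip (f i) *
        finite_dim_hilbert_space.hnorm ip (finite_dim_hilbert_space.pinv scale ip K (f i)) |
        i. 1 \<le> i \<and> i \<le> N}"
    and "I1 = {i \<in> {1..N}. finite_dim_hilbert_space.hnorm ip (f i) *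
        finite_dim_hilbert_space.hnorm ip (finite_dim_hilbert_space.pinv scale ip K (f i)) = L}"
    and "I2 = {1..N} - I1"
    and "V1 = module.span scale (f ` I1)"
    and "V2 = module.span scale (f ` I2)"
    and "V1 \<inter> V2 = {0}"
  shows "finite_dim_hilbert_space.one_erasure_optimal scale ip K N f
    (\<lambda>i. finite_dim_hilbert_space.pinv scale ip K (f i))"
proof -
  interpret finite_dim_hilbert_space scale ip n by fact
  have "{hnorm (f i) * hnorm (pinv K (f i)) | i. 1 \<le> i \<and> i \<le> N}
      = (\<lambda>i. hnorm (f i) * hnorm (pinv K (f i))) ` {1..N}"
    by auto
  then have "L = O1 N f (\<lambda>i. pinv K (f i))"
    using assms(5) by (simp add: O1_def)
  with assms show ?thesis
    by (intro canonical_dual_optimal [of N K f I1]) (auto simp: bounded_operators_eq)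
qed

end
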